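(* Let $u,w\in\mathcal{U}$, let $Y$ be any given sequence space, and suppose that the entries of the infinite matrices $A=(a_{nk})$ and $C=(c_{nk})$ are connected by the relation $$c_{nk}=\sum_{j=1}^{n-1}j\,u_n(w_j-w_{j+1})a_{jk}+n\,u_nw_na_{nk}\qquad\text{for all }k,n\in\mathbb{N}.$$ Then $A\in(Y:\int bv(u,w))$ if and only if $C\in(Y:\ell_1)$.
   Context: Indices run over $\mathbb{N}=\{1,2,3,\dots\}$ and $\omega$ is the space of all real (or complex) sequences; a sequence space is a linear subspace of $\omega$. $\mathcal{U}$ is the set of all sequences $u=(u_k)\in\omega$ with $u_k\neq 0$ for all $k$. $\ell_1$ is the space of absolutely summable sequences. For $u,w\in\mathcal{U}$ define the infinite lower triangular matrix $\Gamma=(\gamma_{nk})$ by $\gamma_{nk}=k\,u_n(w_k-w_{k+1})$ if $k<n$, $\gamma_{nn}=n\,u_nw_n$, $\gamma_{nk}=0$ if $k>n$, and $(\Gamma x)_n=\sum_k\gamma_{nk}x_k$. Define $\int bv(u,w)=\{x\in\omega:\Gamma x\in\ell_1\}$. For sequence spaces $X,Z$ and an infinite matrix $A=(a_{nk})$, $A\in(X:Z)$ means that for every $x\in X$ the series $(Ax)_n=\sum_ka_{nk}x_k$ converges for each $n\in\mathbb{N}$ and the sequence $Ax=((Ax)_n)_n$ belongs to $Z$. *)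

theory Defs
  imports Complex_Main "HOL-Library.Function_Algebras"
begin

text \<open>
  Indices run over \<open>{1, 2, 3, \<dots>}\<close>. A sequence is a function on \<^typ>\<open>nat\<close> normalised to be \<open>0\<close> at the
  unused index \<open>0\<close>, so that sequences correspond one-to-one to functions on the positive integers.
  Row \<open>0\<close> and column \<open>0\<close> of a matrix are never looked at.

  Scalars range over the class \<^class>\<open>real_normed_field\<close>, which covers both \<^typ>\<open>real\<close> and
  \<^typ>\<open>complex\<close>.
\<close>

definition omega :: "(nat \<Rightarrow> 'a::real_normed_field) set" where
  "omega = {x. x 0 = 0}"

abbreviation (input) seq_scale :: "'a::real_normed_field \<Rightarrow> (nat \<Rightarrow> 'a) \<Rightarrow> (nat \<Rightarrow> 'a)" where
  "seq_scale c x \<equiv> (\<lambda>k. c * x k)"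

lemma vector_space_seq_scale:
  "vector_space (seq_scale :: 'a::real_normed_field \<Rightarrow> _)"
  by unfold_locales (auto simp: algebra_simps plus_fun_def)

text \<open>Linearity is over the scalar field itself (in the complex case, complex linearity).\<close>

definition sequence_space :: "(nat \<Rightarrow> 'a::real_normed_field) set \<Rightarrow> bool" where
  "sequence_space X \<longleftrightarrow> X \<subseteq> omega \<and> module.subspace seq_scale X"

definition nonzero_seqs :: "(nat \<Rightarrow> 'a::real_normed_field) set" where
  "nonzero_seqs = {u \<in> omega. \<forall>k\<ge>1. u k \<noteq> 0}"

definition ell1 :: "(nat \<Rightarrow> 'a::real_normed_field) set" where
  "ell1 = {x \<in> omega. summable (\<lambda>k. norm (x (Suc k)))}"

definition row_convergent :: "(nat \<Rightarrow> nat \<Rightarrow> 'a::real_normed_field) \<Rightarrow> (nat \<Rightarrow> 'a) \<Rightarrow> nat \<Rightarrow> bool" where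
  "row_convergent A x n \<longleftrightarrow> summable (\<lambda>k. A n (Suc k) * x (Suc k))"

definition mat_apply :: "(nat \<Rightarrow> nat \<Rightarrow> 'a::real_normed_field) \<Rightarrow> (nat \<Rightarrow> 'a) \<Rightarrow> (nat \<Rightarrow> 'a)" where
  "mat_apply A x = (\<lambda>n. if n = 0 then 0 else (\<Sum>k. A n (Suc k) * x (Suc k)))"

definition matrix_class ::
  "(nat \<Rightarrow> 'a::real_normed_field) set \<Rightarrow> (nat \<Rightarrow> 'a) set \<Rightarrow> (nat \<Rightarrow> nat \<Rightarrow> 'a) set" where
  "matrix_class X Z = {A. \<forall>x\<in>X. (\<forall>n\<ge>1. row_convergent A x n) \<and> mat_apply A x \<in> Z}"

definition Gamma_mat ::
  "(nat \<Rightarrow> 'a::real_normed_field) \<Rightarrow> (nat \<Rightarrow> 'a) \<Rightarrow> (nat \<Rightarrow> nat \<Rightarrow> 'a)" where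
  "Gamma_mat u w n k =
     (if k < n then of_nat k * u n * (w k - w (k + 1))
      else if k = n then of_nat n * u n * w n
      else 0)"

text \<open>The rows of \<^const>\<open>Gamma_mat\<close> are finitely supported, so no convergence condition is needed here.\<close>

definition int_bv :: "(nat \<Rightarrow> 'a::real_normed_field) \<Rightarrow> (nat \<Rightarrow> 'a) \<Rightarrow> (nat \<Rightarrow> 'a) set" where
  "int_bv u w = {x \<in> omega. mat_apply (Gamma_mat u w) x \<in> ell1}"

end

theory Submission
  imports Defs
begin

text \<open>
  The matrix \<open>\<Gamma>\<close> is lower triangular with nonzero diagonal and the relation between the entries says
  \<open>C = \<Gamma>A\<close>. Row \<open>n\<close> of \<open>C\<close> is a finite combination of the rows \<open>1, \<dots>, n\<close> of \<open>A\<close> with nonzero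
  coefficient at row \<open>n\<close>, so by strong induction the rows of \<open>C\<close> converge at \<open>x\<close> exactly when those of
  \<open>A\<close> do, and then \<open>Cx = \<Gamma>(Ax)\<close> since a finite sum may be interchanged with a convergent series.
\<close>

lemma mat_apply_triangular:
  assumes "\<And>k. n < k \<Longrightarrow> T n k = 0" and "1 \<le> n"
  shows "mat_apply T y n = (\<Sum>j = 1..n. T n j * y j)"
proof -
  have "(\<Sum>k. T n (Suc k) * y (Suc k)) = (\<Sum>k<n. T n (Suc k) * y (Suc k))"
    by (rule suminf_finite) (auto simp: assms(1))
  then show ?thesis
    using assms(2) by (simp add: mat_apply_def sum.atLeast1_atMost_eq)
qed

text \<open>A finite combination of convergent series converges termwise. \<open>J\<close> stays
  general because two index sets occur later: \<open>{1..n}\<close> yields a full row of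
  \<open>C\<close>, \<open>{1..<n}\<close> that row without its diagonal contribution.\<close>

lemma row_sums_comb:
  assumes "\<And>k. 1 \<le> k \<Longrightarrow> D k = (\<Sum>j\<in>J. c j * A j k)"
    and "\<And>j. j \<in> J \<Longrightarrow> 1 \<le> j \<and> row_convergent A x j"
  shows "(\<lambda>k. D (Suc k) * x (Suc k)) sums (\<Sum>j\<in>J. c j * mat_apply A x j)"
proof -
  have "(\<lambda>k. \<Sum>j\<in>J. c j * (A j (Suc k) * x (Suc k))) sums (\<Sum>j\<in>J. c j * mat_apply A x j)"
  proof (intro sums_sum sums_mult)
    fix j assume "j \<in> J"
    then show "(\<lambda>k. A j (Suc k) * x (Suc k)) sums mat_apply A x j"
      using assms(2)[of j] by (auto simp: mat_apply_def row_convergent_def summable_sums)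
  qed
  then show ?thesis
    by (simp add: assms(1) sum_distrib_right mult.assoc)
qed

text \<open>\<open>T\<close> abstracts \<open>Gamma_mat u w\<close>, and \<open>product\<close> says
  \<open>C = T A\<close> away from row and column 0.\<close>

context
  fixes T A C :: "nat \<Rightarrow> nat \<Rightarrow> 'a::real_normed_field"
  assumes triangular: "\<And>n k. n < k \<Longrightarrow> T n k = 0"
    and product: "\<And>n k. 1 \<le> n \<Longrightarrow> 1 \<le> k \<Longrightarrow> C n k = (\<Sum>j = 1..n. T n j * A j k)"
begin

lemma triangular_product_row_sums:
  assumes "1 \<le> n" and "\<And>j. 1 \<le> j \<Longrightarrow> j \<le> n \<Longrightarrow> row_convergent A x j"
  shows "(\<lambda>k. C n (Suc k) * x (Suc k)) sums mat_apply T (mat_apply A x) n"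
proof -
  have "mat_apply T (mat_apply A x) n = (\<Sum>j = 1..n. T n j * mat_apply A x j)"
    by (rule mat_apply_triangular) (use triangular assms(1) in auto)
  moreover have "(\<lambda>k. C n (Suc k) * x (Suc k)) sums (\<Sum>j = 1..n. T n j * mat_apply A x j)"
    by (rule row_sums_comb) (use assms product in auto)
  ultimately show ?thesis by simp
qed

lemma triangular_product_mat_apply:
  assumes "\<forall>n\<ge>1. row_convergent A x n"
  shows "mat_apply C x = mat_apply T (mat_apply A x)"
proof
  fix n
  show "mat_apply C x n = mat_apply T (mat_apply A x) n"
    \<comment> \<open>At index 0 both sides are 0 by the convention in
      \<open>mat_apply\<close>.\<close>
    using triangular_product_row_sums[of n x] assms
    by (cases "n = 0") (auto simp: mat_apply_def sums_iff)
qed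

lemma triangular_product_row_convergent_iff:
  assumes diagonal: "\<And>n. 1 \<le> n \<Longrightarrow> T n n \<noteq> 0"
  shows "(\<forall>n\<ge>1. row_convergent C x n) \<longleftrightarrow> (\<forall>n\<ge>1. row_convergent A x n)"
proof
  assume "\<forall>n\<ge>1. row_convergent A x n"
  then show "\<forall>n\<ge>1. row_convergent C x n"
    using triangular_product_row_sums[of _ x]
    by (auto simp: row_convergent_def[of C] sums_iff)
next
  assume C: "\<forall>n\<ge>1. row_convergent C x n"
  have "row_convergent A x n" if "1 \<le> n" for n
    using that
  proof (induction n rule: less_induct)
    case (less n)
    \<comment> \<open>\<open>D\<close> is the share of row \<open>n\<close> of \<open>C\<close> that
      comes from earlier rows of \<open>A\<close>. Its series converges by induction, so subtracting
      it isolates \<open>T n n\<close> times row \<open>n\<close> of \<open>A\<close>.\<close>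
    define D where "D k = (\<Sum>j\<in>{1..<n}. T n j * A j k)" for k
    have "summable (\<lambda>k. D (Suc k) * x (Suc k))"
      using row_sums_comb[of D "T n" A "{1..<n}" x] less.IH D_def
      by (fastforce simp: sums_iff)
    moreover have "summable (\<lambda>k. C n (Suc k) * x (Suc k))"
      using C less.prems by (simp add: row_convergent_def)
    ultimately have "summable (\<lambda>k. C n (Suc k) * x (Suc k) - D (Suc k) * x (Suc k))"
      by (rule summable_diff[rotated])
    moreover have "C n (Suc k) = D (Suc k) + T n n * A n (Suc k)" for k
      using less.prems by (simp add: product D_def flip: sum.last_plus atLeastLessThanSuc_atLeastAtMost)
    ultimately have "summable (\<lambda>k. T n n * (A n (Suc k) * x (Suc k)))"
      by (simp add: algebra_simps)
    \<comment> \<open>The nonzero factor \<open>T n n\<close> can be cancelled.\<close>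
    then show ?case
      using diagonal less.prems by (simp add: row_convergent_def summable_cmult_iff)
  qed
  then show "\<forall>n\<ge>1. row_convergent A x n" by blast
qed

end

theorem theorem4p2:
  fixes u w :: "nat \<Rightarrow> 'a::real_normed_field"
    and Y :: "(nat \<Rightarrow> 'a) set"
    and A C :: "nat \<Rightarrow> nat \<Rightarrow> 'a"
  assumes "u \<in> nonzero_seqs"
    and "w \<in> nonzero_seqs"
    and "sequence_space Y"
    and "\<forall>n\<ge>1. \<forall>k\<ge>1. C n k =
           (\<Sum>j = 1..n - 1. of_nat j * u n * (w j - w (j + 1)) * A j k)
             + of_nat n * u n * w n * A n k"
  shows "A \<in> matrix_class Y (int_bv u w) \<longleftrightarrow> C \<in> matrix_class Y ell1"
proof -
  let ?G = "Gamma_mat u w"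
  have triangular: "?G n k = 0" if "n < k" for n k
    using that by (simp add: Gamma_mat_def)
  have diagonal: "?G n n \<noteq> 0" if "1 \<le> n" for n
    using that assms(1,2) by (simp add: Gamma_mat_def nonzero_seqs_def)
  have product: "C n k = (\<Sum>j = 1..n. ?G n j * A j k)" if "1 \<le> n" "1 \<le> k" for n k
  proof -
    \<comment> \<open>With \<open>n = Suc m\<close> the bound \<open>n - 1\<close> becomes
      \<open>m\<close>, and the diagonal term splits off as the last summand.\<close>
    obtain m where n: "n = Suc m" using \<open>1 \<le> n\<close> by (cases n) auto
    have "(\<Sum>j = 1..m. ?G n j * A j k) = (\<Sum>j = 1..m. of_nat j * u n * (w j - w (j + 1)) * A j k)"
      by (rule sum.cong) (auto simp: Gamma_mat_def n)
    moreover have "?G n n = of_nat n * u n * w n"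
      by (simp add: Gamma_mat_def)
    ultimately show ?thesis
      using assms(4) that by (simp add: n)
  qed
  \<comment> \<open>The equivalence is shown for each single \<open>x\<close>. Either side gives
    convergence of the rows of \<open>A\<close>, hence \<open>Cx = \<Gamma>(Ax)\<close>, and both
    memberships then say that this sequence lies in \<open>ell1\<close>.\<close>
  have "(\<forall>n\<ge>1. row_convergent A x n) \<and> mat_apply A x \<in> int_bv u w \<longleftrightarrow>
        (\<forall>n\<ge>1. row_convergent C x n) \<and> mat_apply C x \<in> ell1" for x
  proof -
    have "mat_apply A x \<in> omega"
      by (simp add: omega_def mat_apply_def)
    then show ?thesis
      using triangular_product_row_convergent_iff[of ?G C A x, OF triangular product diagonal]
        triangular_product_mat_apply[of ?G C A x, OF triangular product]
      by (auto simp: int_bv_def)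
  qed
  then show ?thesis
    by (simp add: matrix_class_def)
qed

end
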